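(* Let $(N,V)$ be the cooperative game associated with a fractional linear production problem, as defined in the context. Then the core of $(N,V)$ is nonempty, i.e. there exists $u=(u_1,\dots,u_n)\in\mathbb{R}^n$ with $\sum_{i\in N}u_i=V(N)$ and $\sum_{i\in S}u_i\ge V(S)$ for every nonempty $S\subseteq N$.
   Context: Let $N=\{1,\dots,n\}$ be the set of players; coalitions are nonempty subsets of $N$. There are $m$ resources and $p$ goods. Player $i$ owns a resource vector $b^i=(b^i_1,\dots,b^i_m)\in\mathbb{R}^m$ with $b^i_k\ge 0$; for a coalition $S$ put $b(S)=\sum_{i\in S}b^i\in\mathbb{R}^m$. Let $A=(a_{kj})\in\mathbb{R}^{m\times p}$, $c,d\in\mathbb{R}^p$, $c_0,d_0\in\mathbb{R}$. Coalition $S$ wants to maximize $\frac{c\cdot x+c_0}{d\cdot x+d_0}$ over $D_S=\{x\in\mathbb{R}^p: Ax\le b(S),\ x\ge 0\}$; it is assumed that $d\cdot x+d_0>0$ for every $x\in D_S$ and every coalition $S$. After the Charnes–Cooper substitution $y=tx$, $t=1/(d\cdot x+d_0)$, one considers, for each coalition $S$, the linear problem $P(S)$: maximize $c\cdot y+c_0t$ over $(y,t)\in\mathbb{R}^p\times\mathbb{R}$ subject to $d\cdot y+d_0t\le 1$, $Ay-t\,b(S)\le 0$, $t>0$, $y\ge 0$. It is assumed that each $P(S)$ has an optimal solution. A collection $\mathcal{B}$ of coalitions is balanced if there are weights $\gamma(S)>0$, $S\in\mathcal{B}$, such that $\sum_{S\in\mathcal{B},\,i\in S}\gamma(S)=1$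 for each $i\in N$. Let $\gamma^*$ be the maximum of $\sum_{S\in\mathcal{B}}\gamma(S)$ over all balanced collections $\mathcal{B}$ (and their balancing weights), and fix a real number $\gamma>\max(\gamma^*,n)$. The game $(N,V)$ is defined by: $V(S)$ is the optimal value of $P(S)$ for every nonempty $S\subsetneq N$, and $V(N)$ is $\gamma$ times the optimal value of $P(N)$. *)

theory Defs
  imports "HOL-Analysis.Analysis"
begin

definition coalitions :: "'i set \<Rightarrow> 'i set set" where
  "coalitions N = {S. S \<subseteq> N \<and> S \<noteq> {}}"

definition balancing_weights :: "'i set \<Rightarrow> 'i set set \<Rightarrow> ('i set \<Rightarrow> real) \<Rightarrow> bool" where
  "balancing_weights N B w \<longleftrightarrow>
     B \<subseteq> coalitions N \<and> (\<forall>S\<in>B. w S > 0) \<and> (\<forall>i\<in>N. (\<Sum>S\<in>{S\<in>B. i \<in> S}. w S) = 1)"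

definition total_weights :: "'i set \<Rightarrow> real set" where
  "total_weights N = {(\<Sum>S\<in>B. w S) | B w. balancing_weights N B w}"

text \<open>For a finite \<open>N\<close> this supremum is a maximum: see \<open>gamma_star_attained\<close> and
  \<open>gamma_star_upper\<close>.\<close>

definition gamma_star :: "'i set \<Rightarrow> real" where
  "gamma_star N = Sup (total_weights N)"

definition total_resources :: "('i \<Rightarrow> real ^ 'm) \<Rightarrow> 'i set \<Rightarrow> real ^ 'm" where
  "total_resources b S = (\<Sum>i\<in>S. b i)"

text \<open>The order on vectors is the componentwise one.\<close>

definition production_set :: "real ^ 'p ^ 'm \<Rightarrow> real ^ 'm \<Rightarrow> (real ^ 'p) set" where
  "production_set A r = {x. A *v x \<le> r \<and> 0 \<le> x}"

text \<open>The Charnes--Cooper linear problem with resource vector \<open>r\<close>; note the strict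
  constraint \<open>t > 0\<close>.\<close>

definition lp_feasible ::
  "real ^ 'p ^ 'm \<Rightarrow> real ^ 'p \<Rightarrow> real \<Rightarrow> real ^ 'm \<Rightarrow> ((real ^ 'p) \<times> real) set" where
  "lp_feasible A d d0 r =
     {(y, t). d \<bullet> y + d0 * t \<le> 1 \<and> A *v y - t *\<^sub>R r \<le> 0 \<and> t > 0 \<and> 0 \<le> y}"

definition lp_objective :: "real ^ 'p \<Rightarrow> real \<Rightarrow> (real ^ 'p) \<times> real \<Rightarrow> real" where
  "lp_objective c c0 = (\<lambda>(y, t). c \<bullet> y + c0 * t)"

definition lp_optimal_solution ::
  "real ^ 'p ^ 'm \<Rightarrow> real ^ 'p \<Rightarrow> real \<Rightarrow> real ^ 'p \<Rightarrow> real \<Rightarrow> real ^ 'm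
     \<Rightarrow> (real ^ 'p) \<times> real \<Rightarrow> bool" where
  "lp_optimal_solution A c c0 d d0 r z \<longleftrightarrow>
     is_arg_max (lp_objective c c0) (\<lambda>z. z \<in> lp_feasible A d d0 r) z"

definition lp_value ::
  "real ^ 'p ^ 'm \<Rightarrow> real ^ 'p \<Rightarrow> real \<Rightarrow> real ^ 'p \<Rightarrow> real \<Rightarrow> real ^ 'm \<Rightarrow> real" where
  "lp_value A c c0 d d0 r = (SUP z\<in>lp_feasible A d d0 r. lp_objective c c0 z)"

definition flp_game ::
  "'i set \<Rightarrow> real ^ 'p ^ 'm \<Rightarrow> ('i \<Rightarrow> real ^ 'm) \<Rightarrow> real ^ 'p \<Rightarrow> real \<Rightarrow> real ^ 'p \<Rightarrow> real
     \<Rightarrow> real \<Rightarrow> 'i set \<Rightarrow> real" where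
  "flp_game N A b c c0 d d0 \<gamma> S =
     (if S = N then \<gamma> * lp_value A c c0 d d0 (total_resources b N)
      else lp_value A c c0 d d0 (total_resources b S))"

text \<open>Payoff vectors are functions on \<open>N\<close>, made unique outside \<open>N\<close> by extensionality.\<close>

definition core :: "'i set \<Rightarrow> ('i set \<Rightarrow> real) \<Rightarrow> ('i \<Rightarrow> real) set" where
  "core N V = {u \<in> N \<rightarrow>\<^sub>E UNIV.
     (\<Sum>i\<in>N. u i) = V N \<and> (\<forall>S\<in>coalitions N. (\<Sum>i\<in>S. u i) \<ge> V S)}"

lemma lp_value_eq:
  assumes "lp_optimal_solution A c c0 d d0 r z"
  shows "lp_value A c c0 d d0 r = lp_objective c c0 z"
  unfolding lp_value_def
  by (rule cSup_eq_maximum)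
     (use assms in \<open>auto simp: lp_optimal_solution_def is_arg_max_linorder\<close>)

lemma total_weight_le_card:
  assumes "finite N" "x \<in> total_weights N"
  shows "x \<le> real (card N)"
proof -
  obtain B w where x: "x = (\<Sum>S\<in>B. w S)" and bw: "balancing_weights N B w"
    using assms(2) by (auto simp: total_weights_def)
  have B: "B \<subseteq> coalitions N" and pos: "\<And>S. S \<in> B \<Longrightarrow> w S > 0"
    and one: "\<And>i. i \<in> N \<Longrightarrow> (\<Sum>S\<in>{S\<in>B. i \<in> S}. w S) = 1"
    using bw by (auto simp: balancing_weights_def)
  have finB: "finite B"
    using B assms(1) by (auto simp: coalitions_def intro: finite_subset[of B "Pow N"])
  have "x \<le> (\<Sum>S\<in>B. \<Sum>i\<in>{i\<in>N. i \<in> S}. w S)"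
    unfolding x
  proof (rule sum_mono)
    fix S assume S: "S \<in> B"
    then have *: "{i\<in>N. i \<in> S} = S" "S \<noteq> {}" "finite S"
      using B assms(1) by (auto simp: coalitions_def intro: finite_subset[of S N])
    then have "1 \<le> card S" by (simp add: Suc_le_eq card_gt_0_iff)
    then have "1 * w S \<le> real (card S) * w S"
      using pos[OF S] by (intro mult_right_mono) auto
    then show "w S \<le> (\<Sum>i\<in>{i\<in>N. i \<in> S}. w S)" using * by simp
  qed
  also have "\<dots> = (\<Sum>i\<in>N. \<Sum>S\<in>{S\<in>B. i \<in> S}. w S)"
    by (rule sum.swap_restrict[OF finB assms(1)])
  also have "\<dots> = real (card N)" using one by simp
  finally show ?thesis .
qed

lemma card_in_total_weights:
  assumes "finite N"
  shows "real (card N) \<in> total_weights N"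
proof -
  let ?B = "(\<lambda>i. {i}) ` N" and ?w = "\<lambda>_. 1 :: real"
  have "{S \<in> ?B. i \<in> S} = {{i}}" if "i \<in> N" for i
    using that by auto
  then have "balancing_weights N ?B ?w"
    by (auto simp: balancing_weights_def coalitions_def)
  moreover have "(\<Sum>S\<in>?B. ?w S) = real (card N)"
    by (simp add: card_image)
  ultimately show ?thesis
    unfolding total_weights_def by (intro CollectI exI[of _ ?B] exI[of _ ?w]) simp
qed

lemma gamma_star_attained:
  assumes "finite N"
  shows "gamma_star N \<in> total_weights N"
proof -
  have "gamma_star N = real (card N)"
    unfolding gamma_star_def
    by (rule cSup_eq_maximum) (use assms card_in_total_weights total_weight_le_card in auto)
  then show ?thesis using card_in_total_weights[OF assms] by simp
qed

lemma gamma_star_upper: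
  assumes "finite N" "x \<in> total_weights N"
  shows "x \<le> gamma_star N"
  unfolding gamma_star_def
  by (rule cSup_upper[OF assms(2)]) (use assms(1) total_weight_le_card in \<open>auto simp: bdd_above_def\<close>)

end

theory Submission imports Defs begin

text \<open>The constraints of \<open>P(S)\<close> survive scaling by \<open>1/2\<close>, so the optimal value
  cannot be negative. Since resources are nonnegative, enlarging a coalition enlarges its feasible
  set, so every optimal value lies between \<open>0\<close> and the value \<open>v\<close> of
  \<open>P(N)\<close>. Splitting \<open>\<gamma> v\<close> equally gives each player at least
  \<open>v\<close> because \<open>\<gamma> \<ge> n\<close>, hence no coalition can improve on it.\<close>

text \<open>All constraints are homogeneous in \<open>(y, t)\<close> except
  \<open>d \<bullet> y + d0 * t \<le> 1\<close>, and halving a number that is at most 1 keeps it at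
  most 1. The factor is positive because the strict constraint \<open>t > 0\<close> rules out the
  origin.\<close>

lemma lp_feasible_halve:
  assumes "(y, t) \<in> lp_feasible A d d0 r"
  shows "((1/2) *\<^sub>R y, t / 2) \<in> lp_feasible A d d0 r"
proof -
  have "A *v ((1/2) *\<^sub>R y) = (1/2) *\<^sub>R (A *v y)"
    by (rule matrix_vector_mult_scaleR)
  moreover have "A *v y - t *\<^sub>R r \<le> 0" "0 \<le> y"
    using assms by (auto simp: lp_feasible_def)
  ultimately show ?thesis
    using assms by (auto simp: lp_feasible_def less_eq_vec_def)
qed

lemma lp_feasible_mono:
  assumes "r \<le> r'"
  shows "lp_feasible A d d0 r \<subseteq> lp_feasible A d d0 r'"
proof clarify
  fix y t assume yt: "(y, t) \<in> lp_feasible A d d0 r"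
  then have t: "t > 0" by (simp add: lp_feasible_def)
  \<comment> \<open>Positivity of \<open>t\<close> turns the larger resource vector into a weaker
    constraint.\<close>
  have "t * r $ k \<le> t * r' $ k" for k
    using assms t by (simp add: less_eq_vec_def)
  then show "(y, t) \<in> lp_feasible A d d0 r'"
    using yt by (auto simp: lp_feasible_def less_eq_vec_def intro: order_trans)
qed

text \<open>Halving an optimal point halves its objective value by linearity; a negative value would
  increase, against optimality.\<close>

lemma lp_value_nonneg:
  assumes opt: "lp_optimal_solution A c c0 d d0 r z"
  shows "0 \<le> lp_value A c c0 d d0 r"
proof -
  obtain y t where z: "z = (y, t)" by (cases z)
  let ?z = "((1/2) *\<^sub>R y, t / 2)"
  have "lp_objective c c0 ?z \<le> lp_objective c c0 z"
    using opt lp_feasible_halve[of y t A d d0 r] z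
    by (auto simp: lp_optimal_solution_def is_arg_max_linorder)
  moreover have "lp_objective c c0 ?z = lp_objective c c0 z / 2"
    by (simp add: lp_objective_def z)
  ultimately show ?thesis
    using lp_value_eq[OF opt] by simp
qed

lemma lp_value_mono:
  assumes "r \<le> r'"
    and opt: "lp_optimal_solution A c c0 d d0 r z"
    and opt': "lp_optimal_solution A c c0 d d0 r' z'"
  shows "lp_value A c c0 d d0 r \<le> lp_value A c c0 d d0 r'"
proof -
  \<comment> \<open>The optimal point for \<open>r\<close> competes in the larger problem.\<close>
  have "z \<in> lp_feasible A d d0 r'"
    using opt lp_feasible_mono[OF assms(1)]
    by (auto simp: lp_optimal_solution_def is_arg_max_linorder)
  then have "lp_objective c c0 z \<le> lp_objective c c0 z'"
    using opt' unfolding lp_optimal_solution_def is_arg_max_linorder by blast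
  then show ?thesis
    by (simp add: lp_value_eq[OF opt] lp_value_eq[OF opt'])
qed

lemma total_resources_mono:
  assumes "finite T" "S \<subseteq> T" "\<And>i k. i \<in> T \<Longrightarrow> b i $ k \<ge> 0"
  shows "total_resources b S \<le> total_resources b T"
  using assms by (auto simp: total_resources_def less_eq_vec_def intro!: sum_mono2)

text \<open>By \<open>VN\<close> each equal share is at least \<open>v\<close>, and a coalition has
  at least one member, so it receives at least \<open>v\<close>.\<close>

lemma equal_split_in_core:
  assumes fin: "finite N" and ne: "N \<noteq> {}" and "0 \<le> v"
    and VN: "real (card N) * v \<le> V N"
    and V: "\<And>S. S \<in> coalitions N \<Longrightarrow> S \<noteq> N \<Longrightarrow> V S \<le> v"
  shows "(\<lambda>i\<in>N. V N / real (card N)) \<in> core N V"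
proof -
  let ?u = "\<lambda>i\<in>N. V N / real (card N)"
  have card: "real (card N) > 0" using fin ne by (simp add: card_gt_0_iff)
  have total: "(\<Sum>i\<in>N. ?u i) = V N" using card by simp
  have "V S \<le> (\<Sum>i\<in>S. ?u i)" if S: "S \<in> coalitions N" for S
  proof (cases "S = N")
    case True
    then show ?thesis using total by simp
  next
    case False
    have sub: "S \<subseteq> N" and "S \<noteq> {}" "finite S"
      using S fin by (auto simp: coalitions_def intro: finite_subset)
    then have "1 \<le> real (card S)" by (simp add: Suc_le_eq card_gt_0_iff)
    \<comment> \<open>The sign of \<open>v\<close> matters here: for \<open>v < 0\<close> more
      members would lower the bound.\<close>
    then have "1 * v \<le> real (card S) * v" using \<open>0 \<le> v\<close> by (rule mult_right_mono)
    then have "V S \<le> real (card S) * v" using V[OF S False] by simp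
    also have "\<dots> \<le> real (card S) * (V N / real (card N))"
      using VN card by (intro mult_left_mono) (simp_all add: field_simps)
    also have "\<dots> = (\<Sum>i\<in>S. V N / real (card N))" by simp
    also have "\<dots> = (\<Sum>i\<in>S. ?u i)" using sub by (intro sum.cong) auto
    finally show ?thesis .
  qed
  with total show ?thesis by (auto simp: core_def)
qed

theorem corollary1:
  fixes n :: nat
    and N :: "nat set"
    and A :: "real ^ 'p ^ 'm"
    and b :: "nat \<Rightarrow> real ^ 'm"
    and c d :: "real ^ 'p"
    and c0 d0 \<gamma> :: real
  assumes "n \<ge> 1"
    and "N = {1..n}"
    and "\<And>i k. i \<in> N \<Longrightarrow> b i $ k \<ge> 0"
    and "\<And>S x. S \<in> coalitions N \<Longrightarrow> x \<in> production_set A (total_resources b S) \<Longrightarrow>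
           d \<bullet> x + d0 > 0"
    and "\<And>S. S \<in> coalitions N \<Longrightarrow>
           \<exists>z. lp_optimal_solution A c c0 d d0 (total_resources b S) z"
    and "\<gamma> > max (gamma_star N) (real n)"
  shows "core N (flp_game N A b c c0 d d0 \<gamma>) \<noteq> {}"
proof -
  let ?V = "flp_game N A b c c0 d d0 \<gamma>"
  let ?val = "\<lambda>S. lp_value A c c0 d d0 (total_resources b S)"
  have fin: "finite N" and ne: "N \<noteq> {}" and card: "card N = n"
    using assms(1,2) by auto
  have N: "N \<in> coalitions N" using ne by (simp add: coalitions_def)
  have nonneg: "0 \<le> ?val N"
    using assms(5)[OF N] lp_value_nonneg by blast
  have "real n * ?val N \<le> \<gamma> * ?val N"
    using assms(6) nonneg by (intro mult_right_mono) auto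
  then have "real (card N) * ?val N \<le> ?V N"
    by (simp add: flp_game_def card)
  \<comment> \<open>For a proper coalition \<open>?V S\<close> is the plain optimal value; the
    factor \<open>\<gamma>\<close> enters at \<open>N\<close> alone.\<close>
  moreover have "?V S \<le> ?val N" if S: "S \<in> coalitions N" "S \<noteq> N" for S
  proof -
    have "total_resources b S \<le> total_resources b N"
      using S fin assms(3) by (intro total_resources_mono) (auto simp: coalitions_def)
    moreover obtain z z' where
      "lp_optimal_solution A c c0 d d0 (total_resources b S) z"
      "lp_optimal_solution A c c0 d d0 (total_resources b N) z'"
      using assms(5)[OF S(1)] assms(5)[OF N] by (elim exE)
    ultimately have "?val S \<le> ?val N" by (rule lp_value_mono)
    then show ?thesis using S(2) by (simp add: flp_game_def)
  qed
  ultimately show ?thesis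
    using equal_split_in_core[OF fin ne nonneg] by blast
qed

end
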